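(* Let $(G,\omega,\mu)$ be a connected, locally finite, infinite weighted graph, and let $d$ be a pseudo metric on $G$ such that: (a) $d$ is intrinsic, i.e. $\frac{1}{\mu(x)}\sum_{y\in G}\omega(x,y)\,d^2(x,y)\le 1$ for all $x\in G$; (b) the jump size $s=\sup\{d(x,y): x,y\in G,\ \omega(x,y)>0\}$ is finite; (c) for every $x\in G$ and $r>0$ the ball $B_r(x)=\{y\in G: d(y,x)<r\}$ is a finite set. Let $V:G\to\mathbb{R}$ satisfy $V(x)\ge 0$ for all $x\in G$ and $$V(x)\ge c_0\, d^{-\alpha}(x,x_0)\quad\text{for all }x\in G\setminus B_{R_0}(x_0),$$ for some $x_0\in G$, $R_0>0$, $c_0>0$ and $\alpha\in[0,1]$. Suppose moreover that there exists $\Lambda\in(0,1)$ such that $$\sum_{x\in G\setminus B_1(x_0)} e^{-\Lambda d^{\alpha}(x,x_0)}\mu(x)<+\infty.$$ If $u:G\to\mathbb{R}$ is a bounded solution of $\Delta u-Vu=0$ in $G$ (i.e. $\Delta u(x)-V(x)u(x)=0$ for every $x\in G$), then $u(x)=0$ for every $x\in G$.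
   Context: An infinite weighted graph $(G,\omega,\mu)$ consists of a countably infinite set $G$, a function $\mu:G\to(0,+\infty)$ (node measure), and a function $\omega:G\times G\to[0,+\infty)$ (edge weight) with $\omega(x,y)=\omega(y,x)$, $\omega(x,x)=0$ and $\sum_{y\in G}\omega(x,y)<\infty$ for all $x,y\in G$. Write $x\sim y$ if $\omega(x,y)>0$. The graph is locally finite if each $x$ has only finitely many $y$ with $y\sim x$; it is connected if any two distinct vertices $x,y$ are joined by a path, i.e. a finite sequence $x=x_0,x_1,\dots,x_n=y$ with $x_k\sim x_{k+1}$ for $k=0,\dots,n-1$. A pseudo metric on $G$ is a symmetric map $d:G\times G\to[0,+\infty)$ with $d(x,x)=0$ satisfying the triangle inequality (possibly $d(x,y)=0$ for $x\neq y$). The Laplacian is $\Delta f(x)=\frac{1}{\mu(x)}\sum_{y\in G}[f(y)-f(x)]\,\omega(x,y)$ for $f:G\to\mathbb{R}$. Notation: $d^{p}(x,y)=(d(x,y))^{p}$. *)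

theory Defs
  imports "HOL-Analysis.Analysis"
begin

text \<open>The vertex set of a graph is the universe of a type, and the sums over it are the
  unordered sums of the library.\<close>

locale infinite_weighted_graph =
  fixes \<omega> :: "'a \<Rightarrow> 'a \<Rightarrow> real" and \<mu> :: "'a \<Rightarrow> real"
  assumes countable_vertices: "countable (UNIV :: 'a set)"
    and infinite_vertices: "infinite (UNIV :: 'a set)"
    and node_measure_pos: "\<mu> x > 0"
    and weight_nonneg: "\<omega> x y \<ge> 0"
    and weight_sym: "\<omega> x y = \<omega> y x"
    and weight_irrefl: "\<omega> x x = 0"
    and weight_summable: "\<omega> x summable_on UNIV"

definition adjacent :: "('a \<Rightarrow> 'a \<Rightarrow> real) \<Rightarrow> 'a \<Rightarrow> 'a \<Rightarrow> bool" where
  "adjacent \<omega> x y \<longleftrightarrow> \<omega> x y > 0"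

definition locally_finite_graph :: "('a \<Rightarrow> 'a \<Rightarrow> real) \<Rightarrow> bool" where
  "locally_finite_graph \<omega> \<longleftrightarrow> (\<forall>x. finite {y. adjacent \<omega> y x})"

definition connected_graph :: "('a \<Rightarrow> 'a \<Rightarrow> real) \<Rightarrow> bool" where
  "connected_graph \<omega> \<longleftrightarrow>
     (\<forall>x y. x \<noteq> y \<longrightarrow>
        (\<exists>(p :: nat \<Rightarrow> 'a) n. p 0 = x \<and> p n = y \<and> (\<forall>k<n. adjacent \<omega> (p k) (p (Suc k)))))"

definition graph_laplacian ::
    "('a \<Rightarrow> 'a \<Rightarrow> real) \<Rightarrow> ('a \<Rightarrow> real) \<Rightarrow> ('a \<Rightarrow> real) \<Rightarrow> 'a \<Rightarrow> real" where
  "graph_laplacian \<omega> \<mu> f x = 1 / \<mu> x * (\<Sum>\<^sub>\<infinity>y. (f y - f x) * \<omega> x y)"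

locale pseudo_metric =
  fixes d :: "'a \<Rightarrow> 'a \<Rightarrow> real"
  assumes nonneg: "d x y \<ge> 0"
    and refl_zero: "d x x = 0"
    and sym: "d x y = d y x"
    and triangle: "d x z \<le> d x y + d y z"

definition pball :: "('a \<Rightarrow> 'a \<Rightarrow> real) \<Rightarrow> 'a \<Rightarrow> real \<Rightarrow> 'a set" where
  "pball d x r = {y. d y x < r}"

text \<open>Summability is required explicitly because \<^const>\<open>infsum\<close> is 0 on families that are
  not summable.\<close>

definition intrinsic ::
    "('a \<Rightarrow> 'a \<Rightarrow> real) \<Rightarrow> ('a \<Rightarrow> real) \<Rightarrow> ('a \<Rightarrow> 'a \<Rightarrow> real) \<Rightarrow> bool" where
  "intrinsic \<omega> \<mu> d \<longleftrightarrow>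
     (\<forall>x. (\<lambda>y. \<omega> x y * (d x y)\<^sup>2) summable_on UNIV \<and>
          1 / \<mu> x * (\<Sum>\<^sub>\<infinity>y. \<omega> x y * (d x y)\<^sup>2) \<le> 1)"

definition jump_size :: "('a \<Rightarrow> 'a \<Rightarrow> real) \<Rightarrow> ('a \<Rightarrow> 'a \<Rightarrow> real) \<Rightarrow> ereal" where
  "jump_size \<omega> d = Sup {ereal (d x y) | x y. \<omega> x y > 0}"

end

theory Submission
  imports Defs
begin

text \<open>On \<open>d(x, x\<^sub>0) \<ge> 1\<close> both the potential bound and the summability are weakest for
  \<open>\<alpha> = 1\<close> and \<open>\<Lambda> = 1\<close>, so only \<open>V \<ge> c / d\<close> and the weight \<open>exp(-d)\<close> matter.
  Normalise the subsolution \<open>\<bar>u\<bar>\<close> to \<open>w\<close> with supremum 1 and test its inequality with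
  \<open>w\<^sup>q \<zeta>\<^sup>2\<close>, where \<open>\<zeta>\<close> is constant near \<open>x\<^sub>0\<close>, decays like \<open>exp(-d)\<close> and vanishes
  for \<open>d \<ge> 2m\<close>. The Caccioppoli error carries a factor \<open>1/q\<close>, so it is absorbed by
  \<open>V\<close> on \<open>d \<le> m\<close> when \<open>q\<close> is a large multiple of \<open>m\<close>; the rest is at most
  \<open>C exp(-m)\<close> because \<open>w \<le> 1\<close>. Hence \<open>w(x)\<^sup>q\<close> is at most \<open>C(x) exp(-\<kappa>q)\<close> with
  \<open>\<kappa>\<close> independent of \<open>x\<close>, and \<open>q \<rightarrow> \<infinity>\<close> gives \<open>w \<le> exp(-\<kappa>) < 1\<close> outside a finite
  ball. The supremum is then attained in the ball, contradicting the maximum principle.\<close>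

section \<open>Edge inequalities and summation by parts\<close>

lemma bernoulli_homogeneous:
  fixes b t :: real
  assumes "0 \<le> b" "0 \<le> t"
  shows "b ^ Suc q + Suc q * b ^ q * t \<le> (b + t) ^ Suc q"
proof (induction q)
  case (Suc q)
  have "b ^ Suc (Suc q) + Suc (Suc q) * b ^ Suc q * t
      \<le> (b + t) * (b ^ Suc q + Suc q * b ^ q * t)"
    using assms by (simp add: algebra_simps)
  also have "\<dots> \<le> (b + t) * (b + t) ^ Suc q"
    using Suc assms by (intro mult_left_mono) auto
  finally show ?case by simp
qed simp

text \<open>Convexity of the power \<open>Suc q\<close> supplies the negative term
  \<open>- Suc q * b ^ q * t\<^sup>2 * z\<^sup>2\<close>. Completing the square against it leaves an
  error carrying \<open>1 / Suc q\<close>. The bound \<open>h \<le> K * z\<close> lets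
  \<open>h\<^sup>2\<close> join the cross term in \<open>z * h\<close>.\<close>

lemma caccioppoli_near:
  fixes a b z h K :: real
  assumes "0 \<le> b" "b \<le> a" "0 \<le> z" "0 \<le> h" "h \<le> K * z" "0 \<le> K"
  shows "(a - b) * (b ^ Suc q * (z + h)\<^sup>2 - a ^ Suc q * z\<^sup>2)
           \<le> (2 + K)\<^sup>2 / (4 * Suc q) * a ^ Suc (Suc q) * h\<^sup>2"
proof -
  define t where "t = a - b"
  have t: "0 \<le> t" "a = b + t" using assms by (auto simp: t_def)
  have conv: "b ^ Suc q + Suc q * b ^ q * t \<le> a ^ Suc q"
    unfolding t(2) by (rule bernoulli_homogeneous) (use t assms in auto)
  have h2: "h\<^sup>2 \<le> K * z * h"
    using assms by (simp add: power2_eq_square mult_right_mono)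
  have "(a - b) * (b ^ Suc q * (z + h)\<^sup>2 - a ^ Suc q * z\<^sup>2)
      \<le> t * (b ^ Suc q * (z + h)\<^sup>2 - (b ^ Suc q + Suc q * b ^ q * t) * z\<^sup>2)"
    using conv t unfolding t_def[symmetric]
    by (intro mult_left_mono diff_left_mono mult_right_mono) auto
  also have "\<dots> = t * b ^ Suc q * (2 * z * h + h\<^sup>2) - Suc q * b ^ q * t\<^sup>2 * z\<^sup>2"
    by (simp add: algebra_simps power2_eq_square)
  also have "\<dots> \<le> t * b ^ Suc q * (2 * z * h + K * z * h) - Suc q * b ^ q * t\<^sup>2 * z\<^sup>2"
    using h2 t assms by (intro diff_right_mono mult_left_mono) auto
  also have "\<dots> = b ^ q * (t * z * (b * (2 + K) * h) - Suc q * (t * z)\<^sup>2)"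
    by (simp add: algebra_simps power2_eq_square)
  also have "\<dots> \<le> b ^ q * ((b * (2 + K) * h)\<^sup>2 / (4 * Suc q))"
  proof (intro mult_left_mono)
    define P Q n where "P = t * z" and "Q = b * (2 + K) * h" and "n = real (Suc q)"
    have "0 < n" by (simp add: n_def)
    have "0 \<le> (2 * n * P - Q)\<^sup>2" by simp
    then have "P * Q - n * P\<^sup>2 \<le> Q\<^sup>2 / (4 * n)"
      using \<open>0 < n\<close> by (simp add: field_simps power2_eq_square)
    then show "t * z * (b * (2 + K) * h) - Suc q * (t * z)\<^sup>2 \<le> (b * (2 + K) * h)\<^sup>2 / (4 * Suc q)"
      by (simp add: P_def Q_def n_def)
  qed (use assms in auto)
  also have "\<dots> = (2 + K)\<^sup>2 / (4 * Suc q) * b ^ Suc (Suc q) * h\<^sup>2"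
    by (simp add: power_mult_distrib) (simp add: power2_eq_square)
  also have "\<dots> \<le> (2 + K)\<^sup>2 / (4 * Suc q) * a ^ Suc (Suc q) * h\<^sup>2"
    using assms by (intro mult_right_mono mult_left_mono power_mono) auto
  finally show ?thesis .
qed

lemma caccioppoli_far:
  fixes a b z h :: real
  assumes "0 \<le> b" "b \<le> a" "a \<le> 1" "0 \<le> z" "0 \<le> h"
  shows "(a - b) * (b ^ Suc q * (z + h)\<^sup>2 - a ^ Suc q * z\<^sup>2) \<le> 2 * h\<^sup>2"
proof -
  define t where "t = a - b"
  have t: "0 \<le> t" "t \<le> 1" "a = b + t" using assms by (auto simp: t_def)
  have bq: "b ^ q \<le> 1" "b ^ Suc q \<le> 1"
    using assms by (auto intro!: power_le_one mult_le_one simp del: power_Suc)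
  have "b ^ Suc q + b ^ q * t \<le> a ^ Suc q"
    using mult_left_mono[OF power_mono[of b a q], of a] t assms by (simp add: algebra_simps)
  then have "(a - b) * (b ^ Suc q * (z + h)\<^sup>2 - a ^ Suc q * z\<^sup>2)
      \<le> t * (b ^ Suc q * (z + h)\<^sup>2 - (b ^ Suc q + b ^ q * t) * z\<^sup>2)"
    using t unfolding t_def[symmetric]
    by (intro mult_left_mono diff_left_mono mult_right_mono) auto
  also have "\<dots> = b ^ q * ((b * h)\<^sup>2 - (t * z - b * h)\<^sup>2) + t * b ^ Suc q * h\<^sup>2"
    by (simp add: algebra_simps power2_eq_square)
  also have "\<dots> \<le> 1 * (b * h)\<^sup>2 + 1 * h\<^sup>2"
  proof (intro add_mono)
    have "b ^ q * ((b * h)\<^sup>2 - (t * z - b * h)\<^sup>2) \<le> b ^ q * (b * h)\<^sup>2"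
      using assms by (intro mult_left_mono) auto
    also have "\<dots> \<le> 1 * (b * h)\<^sup>2" using bq by (intro mult_right_mono) auto
    finally show "b ^ q * ((b * h)\<^sup>2 - (t * z - b * h)\<^sup>2) \<le> 1 * (b * h)\<^sup>2" .
    show "t * b ^ Suc q * h\<^sup>2 \<le> 1 * h\<^sup>2"
      using bq t assms by (intro mult_right_mono mult_le_one) auto
  qed
  also have "(b * h)\<^sup>2 \<le> h\<^sup>2"
    using assms by (simp add: power_mult_distrib mult_left_le_one_le power_le_one)
  finally show ?thesis by simp
qed

text \<open>Exchanging \<open>x\<close> and \<open>y\<close> and averaging replaces the summand by
  \<open>(w x - w y) * (\<phi> y - \<phi> x)\<close>, which is symmetric. Hence it is enough to
  bound an edge from its endpoint with the larger \<open>w\<close>; nonnegativity of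
  \<open>F\<close> pays for the other orientation.\<close>

lemma weighted_sum_by_parts_le:
  fixes \<omega> F :: "'a \<Rightarrow> 'a \<Rightarrow> real" and w \<phi> :: "'a \<Rightarrow> real"
  assumes sym: "\<And>x y. \<omega> x y = \<omega> y x" and nn: "\<And>x y. 0 \<le> \<omega> x y" "\<And>x y. 0 \<le> F x y"
    and le: "\<And>x y. \<lbrakk>0 < \<omega> x y; w y \<le> w x\<rbrakk> \<Longrightarrow> (w x - w y) * (\<phi> y - \<phi> x) \<le> F x y"
  shows "(\<Sum>x\<in>W. \<Sum>y\<in>W. (w y - w x) * \<omega> x y * \<phi> x) \<le> (\<Sum>x\<in>W. \<Sum>y\<in>W. \<omega> x y * F x y)"
    (is "?L \<le> ?R")
proof -
  have swapL: "?L = (\<Sum>x\<in>W. \<Sum>y\<in>W. (w x - w y) * \<omega> x y * \<phi> y)"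
    by (subst sum.swap) (simp add: sym)
  have swapR: "?R = (\<Sum>x\<in>W. \<Sum>y\<in>W. \<omega> x y * F y x)"
    by (subst sum.swap) (simp add: sym)
  have pair: "\<omega> x y * ((w x - w y) * (\<phi> y - \<phi> x)) \<le> \<omega> x y * (F x y + F y x)" for x y
  proof (cases "\<omega> x y > 0")
    case True
    have "(w x - w y) * (\<phi> y - \<phi> x) \<le> F x y + F y x"
    proof (cases "w y \<le> w x")
      case True
      then show ?thesis using le[OF \<open>\<omega> x y > 0\<close>] nn(2)[of y x] by simp
    next
      case False
      then have "(w y - w x) * (\<phi> x - \<phi> y) \<le> F y x"
        using le[of y x] \<open>\<omega> x y > 0\<close> sym by auto
      then show ?thesis using nn(2)[of x y] by (simp add: algebra_simps)
    qed
    then show ?thesis using True by (intro mult_left_mono) auto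
  next
    case False
    then have "\<omega> x y = 0" using nn(1)[of x y] by simp
    then show ?thesis by simp
  qed
  have "2 * ?L = ?L + (\<Sum>x\<in>W. \<Sum>y\<in>W. (w x - w y) * \<omega> x y * \<phi> y)"
    using swapL by simp
  also have "\<dots> = (\<Sum>x\<in>W. \<Sum>y\<in>W. \<omega> x y * ((w x - w y) * (\<phi> y - \<phi> x)))"
    by (simp add: sum.distrib[symmetric] algebra_simps)
  also have "\<dots> \<le> (\<Sum>x\<in>W. \<Sum>y\<in>W. \<omega> x y * (F x y + F y x))"
    by (intro sum_mono pair)
  also have "\<dots> = ?R + (\<Sum>x\<in>W. \<Sum>y\<in>W. \<omega> x y * F y x)"
    by (simp add: sum.distrib algebra_simps)
  also have "\<dots> = 2 * ?R" using swapR by simp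
  finally show ?thesis by simp
qed

section \<open>The exponential cutoff\<close>

definition decay_profile :: "real \<Rightarrow> real \<Rightarrow> real" where
  "decay_profile r t = exp (- max 0 (t - r))"

text \<open>For \<open>r \<le> 2 * m\<close> the subtracted constant is the value of the profile at
  \<open>2 * m\<close>, so the cutoff reaches zero there without a jump, while differences of the
  profile are unaffected by the subtraction.\<close>

definition decay_cutoff :: "real \<Rightarrow> real \<Rightarrow> real \<Rightarrow> real" where
  "decay_cutoff r m t = max 0 (decay_profile r t - exp (r - 2 * m))"

lemma decay_profile_pos: "0 < decay_profile r t"
  by (simp add: decay_profile_def)

lemma decay_cutoff_nonneg: "0 \<le> decay_cutoff r m t"
  by (simp add: decay_cutoff_def)

text \<open>A move by \<open>\<delta>\<close> multiplies the profile by at most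
  \<open>exp \<delta>\<close>, and \<open>exp \<delta> - 1 \<le> \<delta> * exp \<delta>\<close>
  makes the growth linear in \<open>\<delta>\<close>. Truncation at zero cannot enlarge an
  increase.\<close>

lemma decay_cutoff_increment:
  assumes "\<bar>t - t'\<bar> \<le> \<delta>" "\<delta> \<le> s"
  shows "decay_cutoff r m t' - decay_cutoff r m t \<le> decay_profile r t * (\<delta> * exp s)"
proof -
  have \<delta>: "0 \<le> \<delta>" using assms by linarith
  have "decay_profile r t' \<le> decay_profile r t * exp \<delta>"
    using assms unfolding decay_profile_def exp_add[symmetric] by simp
  moreover have "exp \<delta> * (1 - \<delta>) \<le> exp \<delta> * exp (- \<delta>)"
    using exp_ge_add_one_self[of "-\<delta>"] by (intro mult_left_mono) auto
  then have "exp \<delta> - 1 \<le> \<delta> * exp \<delta>"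
    by (simp add: exp_add[symmetric] algebra_simps)
  then have "exp \<delta> - 1 \<le> \<delta> * exp s"
    using assms \<delta> by (meson exp_le_cancel_iff mult_left_mono order_trans)
  then have "decay_profile r t * (exp \<delta> - 1) \<le> decay_profile r t * (\<delta> * exp s)"
    using decay_profile_pos[of r t] by (intro mult_left_mono) auto
  ultimately have "decay_profile r t' - decay_profile r t \<le> decay_profile r t * (\<delta> * exp s)"
    by (simp add: algebra_simps)
  moreover have "0 \<le> decay_profile r t * (\<delta> * exp s)"
    using decay_profile_pos[of r t] \<delta> by simp
  ultimately show ?thesis by (auto simp: decay_cutoff_def)
qed

text \<open>For \<open>t \<le> m\<close> the profile is at least
  \<open>exp m * exp (r - 2 * m)\<close>, so \<open>exp m \<ge> 2\<close> ensures that the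
  subtraction removes at most half of it. Increments of the cutoff are then controlled by the cutoff
  itself, as \<open>caccioppoli_near\<close> demands.\<close>

lemma decay_profile_le_cutoff:
  assumes "t \<le> m" "r \<le> m" "1 \<le> m"
  shows "decay_profile r t \<le> 2 * decay_cutoff r m t"
proof -
  have "2 \<le> exp m" using exp_ge_add_one_self[of m] assms by linarith
  have "2 * exp (r - 2 * m) \<le> exp m * exp (r - 2 * m)"
    using \<open>2 \<le> exp m\<close> by simp
  also have "\<dots> = exp (- (m - r))" by (simp add: exp_add[symmetric])
  also have "\<dots> \<le> decay_profile r t" using assms by (simp add: decay_profile_def)
  finally have "2 * exp (r - 2 * m) \<le> decay_profile r t" .
  moreover have "decay_profile r t - exp (r - 2 * m) \<le> decay_cutoff r m t"
    by (simp add: decay_cutoff_def)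
  ultimately show ?thesis by linarith
qed

lemma decay_cutoff_eq_0:
  assumes "2 * m \<le> t" "r \<le> 2 * m"
  shows "decay_cutoff r m t = 0"
  using assms by (simp add: decay_cutoff_def decay_profile_def)

text \<open>Beyond \<open>r\<close> the square holds two factors \<open>exp (- t)\<close>: one is
  spent on \<open>exp (- m)\<close>, the other stays as the summable weight. Up to \<open>r\<close>
  the profile is 1 and the exponent on the right is nonnegative.\<close>

lemma decay_profile_square_le:
  assumes "m \<le> t"
  shows "(decay_profile r t)\<^sup>2 \<le> exp (2 * r - m) * exp (- t)"
  using assms by (auto simp: decay_profile_def exp_add[symmetric] power2_eq_square max_def)

section \<open>The weighted energy estimate\<close>

locale proper_intrinsic_graph = infinite_weighted_graph \<omega> \<mu> + pseudo_metric d
  for \<omega> d :: "'a \<Rightarrow> 'a \<Rightarrow> real" and \<mu> :: "'a \<Rightarrow> real" +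
  fixes s :: real and x\<^sub>0 :: 'a
  assumes finite_neighbours: "finite {y. \<omega> x y > 0}"
    and intrinsic_sum_le: "finite A \<Longrightarrow> (\<Sum>y\<in>A. \<omega> x y * (d x y)\<^sup>2) \<le> \<mu> x"
    and jump_le: "\<omega> x y > 0 \<Longrightarrow> d x y \<le> s"
    and jump_nonneg: "0 \<le> s"
    and finite_ball: "finite {y. d y x\<^sub>0 < r}"
begin

lemma weight_pos_iff: "\<omega> x y \<noteq> 0 \<longleftrightarrow> 0 < \<omega> x y"
  using weight_nonneg[of x y] by linarith

lemma abs_distance_diff_le: "\<bar>d x x\<^sub>0 - d y x\<^sub>0\<bar> \<le> d x y"
  using triangle[of x x\<^sub>0 y] triangle[of y x\<^sub>0 x] sym[of x y] by linarith

text \<open>\<open>caccioppoli_near\<close> with \<open>K = 2 * exp s * s\<close> contributes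
  \<open>(2 + K)\<^sup>2 / 4\<close>; the factor \<open>(2 * exp s)\<^sup>2\<close> comes from the
  bound of the cutoff increment by \<open>2 * exp s * \<zeta> x * d x y\<close>.\<close>

definition energy_const :: real where
  "energy_const = (2 + 2 * exp s * s)\<^sup>2 * (2 * exp s)\<^sup>2 / 4"

lemma energy_const_pos: "0 < energy_const"
proof -
  have "0 < 2 + 2 * exp s * s" using jump_nonneg by (simp add: add_pos_nonneg)
  then show ?thesis by (simp add: energy_const_def)
qed

text \<open>The edge error is charged to the endpoint with the larger value of \<open>w\<close>.  It vanishes
  for \<open>d(x, x\<^sub>0) < R\<close>, since then the cutoff is constant on all neighbours of \<open>x\<close>; this is
  why the profile starts to decay only at \<open>R + s\<close>.\<close>

definition error_density :: "('a \<Rightarrow> real) \<Rightarrow> nat \<Rightarrow> real \<Rightarrow> real \<Rightarrow> 'a \<Rightarrow> real" where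
  "error_density w q R m x =
     (if d x x\<^sub>0 < R then 0
      else if d x x\<^sub>0 \<le> m
        then energy_const / Suc q * w x ^ Suc (Suc q) * (decay_cutoff (R + s) m (d x x\<^sub>0))\<^sup>2
        else 2 * (exp s * decay_profile (R + s) (d x x\<^sub>0))\<^sup>2)"

lemma error_density_nonneg:
  assumes "\<And>x. 0 \<le> w x"
  shows "0 \<le> error_density w q R m x"
  using assms energy_const_pos by (simp add: error_density_def)

lemma edge_energy_le:
  assumes w: "\<And>x. 0 \<le> w x" "\<And>x. w x \<le> 1"
    and m: "R + s \<le> m" "1 \<le> m" and xy: "0 < \<omega> x y" "w y \<le> w x"
  defines "\<zeta> \<equiv> \<lambda>x. decay_cutoff (R + s) m (d x x\<^sub>0)"
  shows "(w x - w y) * (w y ^ Suc q * (\<zeta> y)\<^sup>2 - w x ^ Suc q * (\<zeta> x)\<^sup>2)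
           \<le> (d x y)\<^sup>2 * error_density w q R m x"
proof (cases "\<zeta> y \<le> \<zeta> x")
  case True
  have "w y ^ Suc q * (\<zeta> y)\<^sup>2 \<le> w x ^ Suc q * (\<zeta> x)\<^sup>2"
    using True w xy by (intro mult_mono power_mono) (auto simp: \<zeta>_def decay_cutoff_nonneg)
  then have "(w x - w y) * (w y ^ Suc q * (\<zeta> y)\<^sup>2 - w x ^ Suc q * (\<zeta> x)\<^sup>2) \<le> 0"
    using xy by (intro mult_nonneg_nonpos) auto
  also have "0 \<le> (d x y)\<^sup>2 * error_density w q R m x"
    by (simp add: error_density_nonneg w)
  finally show ?thesis .
next
  case False
  define h where "h = \<zeta> y - \<zeta> x"
  define E where "E = decay_profile (R + s) (d x x\<^sub>0)"
  have "0 \<le> E" by (simp add: E_def decay_profile_pos less_imp_le)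
  have h: "0 \<le> h" "\<zeta> y = \<zeta> x + h" using False by (auto simp: h_def)
  have \<zeta>: "0 \<le> \<zeta> x" by (simp add: \<zeta>_def decay_cutoff_nonneg)
  have hE: "h \<le> E * (d x y * exp s)"
    unfolding h_def \<zeta>_def E_def
    by (intro decay_cutoff_increment abs_distance_diff_le jump_le xy)
  have R: "R \<le> d x x\<^sub>0"
  proof (rule ccontr)
    assume "\<not> R \<le> d x x\<^sub>0"
    then have "d x x\<^sub>0 < R + s" "d y x\<^sub>0 < R + s"
      using abs_distance_diff_le[of x y] jump_le[OF xy(1)] jump_nonneg by linarith+
    then show False using False by (simp add: \<zeta>_def decay_cutoff_def decay_profile_def)
  qed
  show ?thesis
  proof (cases "d x x\<^sub>0 \<le> m")
    case True
    have scaling: "X\<^sup>2 / (4 * n) * P * (k * z * l)\<^sup>2 = l\<^sup>2 * (X\<^sup>2 * k\<^sup>2 / 4 / n * P * z\<^sup>2)"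
      for X n P k z l :: real
      by (simp add: power_mult_distrib)
    have density: "error_density w q R m x =
        (2 + 2 * exp s * s)\<^sup>2 * (2 * exp s)\<^sup>2 / 4 / Suc q * w x ^ Suc (Suc q) * (\<zeta> x)\<^sup>2"
      using R True by (simp add: error_density_def energy_const_def \<zeta>_def)
    \<comment> \<open>Two bounds on \<open>h\<close> follow. The one linear in \<open>d x y\<close>
      yields the factor \<open>(d x y)\<^sup>2\<close>; the one with \<open>d x y\<close> replaced
      by \<open>s\<close> yields the constant \<open>K\<close>.\<close>
    have "E \<le> 2 * \<zeta> x"
      unfolding E_def \<zeta>_def by (rule decay_profile_le_cutoff) (use True m in auto)
    then have "E * (d x y * exp s) \<le> 2 * \<zeta> x * (d x y * exp s)"
      by (intro mult_right_mono) (auto simp: nonneg)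
    from order_trans[OF hE this] have h1: "h \<le> 2 * exp s * \<zeta> x * d x y"
      by (simp only: mult_ac)
    also have "\<dots> \<le> 2 * exp s * \<zeta> x * s"
      using \<zeta> jump_le[OF xy(1)] by (intro mult_left_mono) auto
    finally have h2: "h \<le> (2 * exp s * s) * \<zeta> x" by (simp add: mult_ac)
    have "(w x - w y) * (w y ^ Suc q * (\<zeta> x + h)\<^sup>2 - w x ^ Suc q * (\<zeta> x)\<^sup>2)
        \<le> (2 + 2 * exp s * s)\<^sup>2 / (4 * Suc q) * w x ^ Suc (Suc q) * h\<^sup>2"
      by (rule caccioppoli_near) (use w xy \<zeta> h h2 jump_nonneg in auto)
    also have "\<dots> \<le> (2 + 2 * exp s * s)\<^sup>2 / (4 * Suc q) * w x ^ Suc (Suc q)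
        * (2 * exp s * \<zeta> x * d x y)\<^sup>2"
      using h h1 w by (intro mult_left_mono power_mono) auto
    also have "\<dots> = (d x y)\<^sup>2 * error_density w q R m x"
      unfolding density of_nat_mult of_nat_numeral by (rule scaling)
    finally show ?thesis by (simp add: h)
  next
    case far: False
    have "(w x - w y) * (w y ^ Suc q * (\<zeta> x + h)\<^sup>2 - w x ^ Suc q * (\<zeta> x)\<^sup>2) \<le> 2 * h\<^sup>2"
      by (rule caccioppoli_far) (use w xy \<zeta> h in auto)
    also have "\<dots> \<le> 2 * (E * (d x y * exp s))\<^sup>2"
      using h hE by (intro mult_left_mono power_mono) auto
    also have "\<dots> = (d x y)\<^sup>2 * error_density w q R m x"
      using R far by (simp add: error_density_def power_mult_distrib E_def)
    finally show ?thesis by (simp add: h)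
  qed
qed

text \<open>The subsolution inequality is multiplied by
  \<open>w x ^ Suc q * (\<zeta> x)\<^sup>2\<close> and summed by parts. The error density depends on
  \<open>x\<close> alone, so the intrinsic condition collapses the inner sum of
  \<open>\<omega> x y * (d x y)\<^sup>2\<close> to \<open>\<mu> x\<close>.\<close>

lemma energy_estimate:
  assumes w: "\<And>x. 0 \<le> w x" "\<And>x. w x \<le> 1"
    and sub: "\<And>x. V x * w x * \<mu> x \<le> (\<Sum>y | \<omega> x y > 0. (w y - w x) * \<omega> x y)"
    and m: "R + s \<le> m" "1 \<le> m"
  defines "\<zeta> \<equiv> \<lambda>x. decay_cutoff (R + s) m (d x x\<^sub>0)"
    and "W \<equiv> {x. d x x\<^sub>0 < 2 * m + s + 1}"
  shows "(\<Sum>x\<in>W. V x * w x ^ Suc (Suc q) * (\<zeta> x)\<^sup>2 * \<mu> x) \<le> (\<Sum>x\<in>W. error_density w q R m x * \<mu> x)"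
proof -
  have finW: "finite W" unfolding W_def by (rule finite_ball)
  define \<phi> where "\<phi> = (\<lambda>x. w x ^ Suc q * (\<zeta> x)\<^sup>2)"
  have \<phi>: "0 \<le> \<phi> x" for x by (simp add: \<phi>_def w)
  have "(\<Sum>x\<in>W. V x * w x ^ Suc (Suc q) * (\<zeta> x)\<^sup>2 * \<mu> x) = (\<Sum>x\<in>W. V x * w x * \<mu> x * \<phi> x)"
    by (simp add: \<phi>_def mult_ac)
  also have "\<dots> \<le> (\<Sum>x\<in>W. \<Sum>y\<in>W. (w y - w x) * \<omega> x y * \<phi> x)"
  proof (rule sum_mono)
    fix x assume "x \<in> W"
    show "V x * w x * \<mu> x * \<phi> x \<le> (\<Sum>y\<in>W. (w y - w x) * \<omega> x y * \<phi> x)"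
    proof (cases "d x x\<^sub>0 < 2 * m")
      case True
      \<comment> \<open>\<open>W\<close> exceeds the support of the cutoff by more than one jump, so
        restricting the Laplacian to \<open>W\<close> loses no neighbour of a vertex in the
        support.\<close>
      have "{y. \<omega> x y > 0} \<subseteq> W"
      proof
        fix y assume "y \<in> {y. \<omega> x y > 0}"
        then show "y \<in> W"
          using abs_distance_diff_le[of x y] jump_le[of x y] True by (simp add: W_def)
      qed
      then have "(\<Sum>y | \<omega> x y > 0. (w y - w x) * \<omega> x y) = (\<Sum>y\<in>W. (w y - w x) * \<omega> x y)"
        using finW weight_pos_iff by (intro sum.mono_neutral_left) auto
      then have "V x * w x * \<mu> x * \<phi> x \<le> (\<Sum>y\<in>W. (w y - w x) * \<omega> x y) * \<phi> x"
        using sub[of x] \<phi> by (intro mult_right_mono) auto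
      then show ?thesis by (simp add: sum_distrib_right)
    next
      case False
      then have "\<phi> x = 0"
        using m jump_nonneg by (simp add: \<phi>_def \<zeta>_def decay_cutoff_eq_0)
      then show ?thesis by simp
    qed
  qed
  also have "\<dots> \<le> (\<Sum>x\<in>W. \<Sum>y\<in>W. \<omega> x y * ((d x y)\<^sup>2 * error_density w q R m x))"
  proof (rule weighted_sum_by_parts_le)
    show "(w x - w y) * (\<phi> y - \<phi> x) \<le> (d x y)\<^sup>2 * error_density w q R m x"
      if "0 < \<omega> x y" "w y \<le> w x" for x y
      unfolding \<phi>_def \<zeta>_def by (rule edge_energy_le) (use w m that in auto)
  qed (auto simp: weight_sym weight_nonneg error_density_nonneg w intro: weight_sym)
  also have "\<dots> = (\<Sum>x\<in>W. error_density w q R m x * (\<Sum>y\<in>W. \<omega> x y * (d x y)\<^sup>2))"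
    by (simp add: sum_distrib_left mult_ac)
  also have "\<dots> \<le> (\<Sum>x\<in>W. error_density w q R m x * \<mu> x)"
    using finW by (intro sum_mono mult_left_mono intrinsic_sum_le error_density_nonneg w)
  finally show ?thesis .
qed

section \<open>From the energy estimate to the gap below the supremum\<close>

lemma pointwise_decay:
  assumes w: "\<And>x. 0 \<le> w x" "\<And>x. w x \<le> 1" and V: "\<And>x. 0 \<le> V x"
    and sub: "\<And>x. V x * w x * \<mu> x \<le> (\<Sum>y | \<omega> x y > 0. (w y - w x) * \<omega> x y)"
    and R: "1 \<le> R" and c: "0 < c" and Vc: "\<And>x. R \<le> d x x\<^sub>0 \<Longrightarrow> c / d x x\<^sub>0 \<le> V x"
    and S: "\<And>A. \<lbrakk>finite A; \<And>x. x \<in> A \<Longrightarrow> 1 \<le> d x x\<^sub>0\<rbrakk> \<Longrightarrow> (\<Sum>x\<in>A. exp (- d x x\<^sub>0) * \<mu> x) \<le> S"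
    and m: "m = c / (2 * energy_const) * Suc q" "R + s \<le> m" and x: "R \<le> d x x\<^sub>0" "d x x\<^sub>0 \<le> m"
  shows "V x * w x ^ Suc (Suc q) * (decay_profile (R + s) (d x x\<^sub>0))\<^sup>2 * \<mu> x
           \<le> 16 * exp (2 * s) * exp (2 * (R + s)) * S * exp (- m)"
proof -
  define \<zeta> where "\<zeta> = (\<lambda>x. decay_cutoff (R + s) m (d x x\<^sub>0))"
  define W where "W = {x. d x x\<^sub>0 < 2 * m + s + 1}"
  define B where "B = {x \<in> W. m < d x x\<^sub>0}"
  define G where "G = (\<lambda>x. V x * w x ^ Suc (Suc q) * (\<zeta> x)\<^sup>2 * \<mu> x)"
  define T where "T = (\<lambda>x. if x \<in> B then 2 * (exp s * decay_profile (R + s) (d x x\<^sub>0))\<^sup>2 * \<mu> x else 0)"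
  have m1: "1 \<le> m" using R m jump_nonneg by linarith
  have finW: "finite W" unfolding W_def by (rule finite_ball)
  have \<mu>: "0 \<le> \<mu> x" for x using node_measure_pos[of x] by simp
  have G: "0 \<le> G x" for x by (simp add: G_def V w \<mu>)
  \<comment> \<open>The choice of \<open>m\<close> makes this half of \<open>c / m\<close>, a lower
    bound for \<open>V\<close> on \<open>R \<le> d x x\<^sub>0 \<le> m\<close>; the error there is
    at most half of \<open>G\<close>.\<close>
  have Cq: "energy_const / Suc q = c / (2 * m)"
    unfolding m(1) using energy_const_pos c by simp
  have err: "error_density w q R m x * \<mu> x \<le> G x / 2 + T x" if "x \<in> W" for x
  proof -
    consider "d x x\<^sub>0 < R" | "R \<le> d x x\<^sub>0" "d x x\<^sub>0 \<le> m" | "m < d x x\<^sub>0" "R \<le> d x x\<^sub>0"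
      using m jump_nonneg by linarith
    then show ?thesis
    proof cases
      case 1
      then show ?thesis using G[of x] \<mu>[of x] by (simp add: error_density_def T_def)
    next
      case 2
      have "c / m \<le> c / d x x\<^sub>0" using 2 R c by (intro divide_left_mono) auto
      also have "\<dots> \<le> V x" by (rule Vc) (rule 2)
      finally have "c / (2 * m) \<le> V x / 2" by simp
      then have "c / (2 * m) * (w x ^ Suc (Suc q) * (\<zeta> x)\<^sup>2 * \<mu> x)
          \<le> V x / 2 * (w x ^ Suc (Suc q) * (\<zeta> x)\<^sup>2 * \<mu> x)"
        using w \<mu> by (intro mult_right_mono) auto
      moreover have "error_density w q R m x * \<mu> x = c / (2 * m) * (w x ^ Suc (Suc q) * (\<zeta> x)\<^sup>2 * \<mu> x)"
        using 2 unfolding error_density_def Cq by (simp add: \<zeta>_def)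
      moreover have "T x = 0" using 2 by (simp add: T_def B_def)
      ultimately show ?thesis by (simp add: G_def mult_ac)
    next
      case 3
      then show ?thesis using that G[of x] by (simp add: error_density_def T_def B_def)
    qed
  qed
  have "sum G W \<le> (\<Sum>x\<in>W. error_density w q R m x * \<mu> x)"
    unfolding G_def \<zeta>_def W_def by (rule energy_estimate) (use w sub m m1 in auto)
  also have "\<dots> \<le> (\<Sum>x\<in>W. G x / 2 + T x)" by (intro sum_mono err)
  also have "\<dots> = sum G W / 2 + sum T W" by (simp add: sum.distrib sum_divide_distrib)
  \<comment> \<open>The sum is finite, so half of it moves to the left and only the far part
    \<open>T\<close> remains.\<close>
  finally have GT: "sum G W \<le> 2 * sum T W" by simp
  have "sum T W = (\<Sum>x\<in>B. 2 * (exp s * decay_profile (R + s) (d x x\<^sub>0))\<^sup>2 * \<mu> x)"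
    unfolding T_def B_def by (simp add: sum.inter_filter[OF finW, symmetric] sum.If_cases finW)
  also have "\<dots> \<le> (\<Sum>x\<in>B. 2 * exp (2 * s) * exp (2 * (R + s) - m) * (exp (- d x x\<^sub>0) * \<mu> x))"
  proof (rule sum_mono)
    fix x assume "x \<in> B"
    then have "(decay_profile (R + s) (d x x\<^sub>0))\<^sup>2 \<le> exp (2 * (R + s) - m) * exp (- d x x\<^sub>0)"
      by (intro decay_profile_square_le) (auto simp: B_def)
    then have "2 * exp (2 * s) * (decay_profile (R + s) (d x x\<^sub>0))\<^sup>2 * \<mu> x
        \<le> 2 * exp (2 * s) * (exp (2 * (R + s) - m) * exp (- d x x\<^sub>0)) * \<mu> x"
      using \<mu> by (intro mult_right_mono mult_left_mono) auto
    then show "2 * (exp s * decay_profile (R + s) (d x x\<^sub>0))\<^sup>2 * \<mu> x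
        \<le> 2 * exp (2 * s) * exp (2 * (R + s) - m) * (exp (- d x x\<^sub>0) * \<mu> x)"
      by (simp add: power_mult_distrib exp_double[symmetric] mult_ac)
  qed
  also have "\<dots> = 2 * exp (2 * s) * exp (2 * (R + s) - m) * (\<Sum>x\<in>B. exp (- d x x\<^sub>0) * \<mu> x)"
    by (simp add: sum_distrib_left)
  also have "\<dots> \<le> 2 * exp (2 * s) * exp (2 * (R + s) - m) * S"
    using finW m1 by (intro mult_left_mono S) (auto simp: B_def)
  also have "\<dots> = 2 * exp (2 * s) * exp (2 * (R + s)) * S * exp (- m)"
    by (simp add: exp_diff exp_minus field_simps)
  finally have T: "sum T W \<le> 2 * exp (2 * s) * exp (2 * (R + s)) * S * exp (- m)" .
  have "x \<in> W" using x m1 jump_nonneg by (simp add: W_def)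
  then have Gx: "G x \<le> sum G W" using finW G by (intro member_le_sum) auto
  have "decay_profile (R + s) (d x x\<^sub>0) \<le> 2 * \<zeta> x"
    unfolding \<zeta>_def by (rule decay_profile_le_cutoff) (use x m m1 in auto)
  then have "(decay_profile (R + s) (d x x\<^sub>0))\<^sup>2 \<le> (2 * \<zeta> x)\<^sup>2"
    by (intro power_mono) (auto simp: decay_profile_pos less_imp_le)
  then have "V x * w x ^ Suc (Suc q) * (decay_profile (R + s) (d x x\<^sub>0))\<^sup>2 * \<mu> x
      \<le> V x * w x ^ Suc (Suc q) * (2 * \<zeta> x)\<^sup>2 * \<mu> x"
    using w V \<mu> by (intro mult_right_mono mult_left_mono) auto
  also have "\<dots> = 4 * G x" by (simp add: G_def power_mult_distrib mult_ac)
  \<comment> \<open>The factor 4 comes from replacing the profile by the cutoff, one 2 from the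
    absorption and the other from \<open>caccioppoli_far\<close>.\<close>
  also have "\<dots> \<le> 4 * (2 * (2 * exp (2 * s) * exp (2 * (R + s)) * S * exp (- m)))"
    using Gx GT T by linarith
  finally show ?thesis by simp
qed

lemma subsolution_gap:
  assumes w: "\<And>x. 0 \<le> w x" "\<And>x. w x \<le> 1" and V: "\<And>x. 0 \<le> V x"
    and sub: "\<And>x. V x * w x * \<mu> x \<le> (\<Sum>y | \<omega> x y > 0. (w y - w x) * \<omega> x y)"
    and R: "1 \<le> R" and c: "0 < c" and Vc: "\<And>x. R \<le> d x x\<^sub>0 \<Longrightarrow> c / d x x\<^sub>0 \<le> V x"
    and S: "\<And>A. \<lbrakk>finite A; \<And>x. x \<in> A \<Longrightarrow> 1 \<le> d x x\<^sub>0\<rbrakk> \<Longrightarrow> (\<Sum>x\<in>A. exp (- d x x\<^sub>0) * \<mu> x) \<le> S"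
    and x: "R \<le> d x x\<^sub>0"
  shows "w x \<le> exp (- (c / (2 * energy_const)))"
proof (rule ccontr)
  define \<kappa> where "\<kappa> = c / (2 * energy_const)"
  \<comment> \<open>One factor \<open>w x\<close> goes into \<open>P\<close>, so that the remaining
    power \<open>Suc q\<close> matches the decay \<open>exp (- (\<kappa> * Suc q))\<close>.\<close>
  define P where "P = V x * (decay_profile (R + s) (d x x\<^sub>0))\<^sup>2 * \<mu> x * w x"
  define D where "D = 16 * exp (2 * s) * exp (2 * (R + s)) * S"
  define y where "y = w x * exp \<kappa>"
  assume "\<not> w x \<le> exp (- (c / (2 * energy_const)))"
  then have gt: "exp (- \<kappa>) < w x" by (simp add: \<kappa>_def)
  then have "exp \<kappa> * exp (- \<kappa>) < exp \<kappa> * w x" by (intro mult_strict_left_mono) auto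
  then have y: "1 < y" by (simp add: y_def exp_add[symmetric] mult.commute)
  have \<kappa>: "0 < \<kappa>" using c energy_const_pos by (simp add: \<kappa>_def)
  have "0 < c / d x x\<^sub>0" using c R x by simp
  then have "0 < V x" using Vc[OF x] by linarith
  then have P: "0 < P"
    using gt node_measure_pos[of x] decay_profile_pos[of "R + s" "d x x\<^sub>0"]
    by (simp add: P_def less_trans[OF exp_gt_zero gt])
  have bound: "P * y ^ Suc q \<le> D" if q: "max (R + s) (d x x\<^sub>0) \<le> \<kappa> * Suc q" for q
  proof -
    have "P * w x ^ Suc q \<le> D * exp (- (\<kappa> * Suc q))"
      using pointwise_decay[OF w V sub R c Vc S refl, of q x] q x
      by (simp add: P_def D_def \<kappa>_def mult_ac)
    then have "P * w x ^ Suc q * exp (\<kappa> * Suc q) \<le> D * exp (- (\<kappa> * Suc q)) * exp (\<kappa> * Suc q)"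
      by (intro mult_right_mono) auto
    also have "\<dots> = D" by (simp add: exp_add[symmetric] mult.assoc)
    finally show ?thesis
      by (simp only: y_def power_mult_distrib exp_of_nat_mult[symmetric] mult_ac)
  qed
  \<comment> \<open>\<open>n\<close> lets the powers of \<open>y > 1\<close> exceed
    \<open>D / P\<close>, and \<open>k\<close> makes \<open>m = \<kappa> * Suc q\<close> large
    enough for \<open>pointwise_decay\<close> to apply at \<open>x\<close>.\<close>
  obtain n where n: "D / P < y ^ n" using real_arch_pow[OF y] by blast
  obtain k where k: "max (R + s) (d x x\<^sub>0) / \<kappa> < real k" using reals_Archimedean2 by blast
  define q where "q = max n k"
  have "max (R + s) (d x x\<^sub>0) < \<kappa> * real k" using k \<kappa> by (simp add: field_simps)
  also have "\<dots> \<le> \<kappa> * real (Suc q)" using \<kappa> by (intro mult_left_mono) (auto simp: q_def)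
  finally have "P * y ^ Suc q \<le> D" by (intro bound) auto
  moreover have "y ^ n \<le> y ^ Suc q" using y by (intro power_increasing) (auto simp: q_def)
  then have "D / P < y ^ Suc q" using n by linarith
  then have "D < P * y ^ Suc q" using P by (simp add: field_simps)
  ultimately show False by linarith
qed

section \<open>Maximum principle and vanishing of bounded subsolutions\<close>

lemma subsolution_eq_1:
  assumes conn: "connected_graph \<omega>"
    and w: "\<And>x. 0 \<le> w x" "\<And>x. w x \<le> 1" and V: "\<And>x. 0 \<le> V x"
    and sub: "\<And>x. V x * w x * \<mu> x \<le> (\<Sum>y | \<omega> x y > 0. (w y - w x) * \<omega> x y)"
    and z: "w z = 1"
  shows "w x = 1"
proof -
  \<comment> \<open>Where \<open>w\<close> is 1 no summand of the Laplacian is positive, yet the sum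
    is at least \<open>V x * w x * \<mu> x \<ge> 0\<close>. So every summand vanishes and the value
    1 passes to all neighbours.\<close>
  have step: "w y = 1" if "w x = 1" "\<omega> x y > 0" for x y
  proof -
    have "0 \<le> V x * w x * \<mu> x" using V w node_measure_pos[of x] by simp
    then have "(\<Sum>y | \<omega> x y > 0. (1 - w y) * \<omega> x y) \<le> 0"
      using sub[of x] that by (simp add: sum_negf[symmetric] algebra_simps sum_subtractf)
    moreover have nn: "0 \<le> (1 - w y) * \<omega> x y" for y using w weight_nonneg by simp
    ultimately have "(\<Sum>y | \<omega> x y > 0. (1 - w y) * \<omega> x y) = 0"
      by (intro antisym sum_nonneg) auto
    then have "(1 - w y) * \<omega> x y = 0"
      using that nn by (subst (asm) sum_nonneg_eq_0_iff) (auto simp: finite_neighbours)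
    then show ?thesis using that by simp
  qed
  show ?thesis
  proof (cases "z = x")
    case False
    then obtain p n where p: "p 0 = z" "p n = x" "\<And>k. k < n \<Longrightarrow> \<omega> (p k) (p (Suc k)) > 0"
      using conn unfolding connected_graph_def adjacent_def by metis
    have "k \<le> n \<Longrightarrow> w (p k) = 1" for k
      by (induction k) (use p z step in auto)
    then show ?thesis using p by blast
  qed (use z in simp)
qed

lemma bounded_subsolution_eq_0:
  assumes conn: "connected_graph \<omega>" and v: "\<And>x. 0 \<le> v x" "bdd_above (range v)"
    and V: "\<And>x. 0 \<le> V x"
    and sub: "\<And>x. V x * v x * \<mu> x \<le> (\<Sum>y | \<omega> x y > 0. (v y - v x) * \<omega> x y)"
    and R: "1 \<le> R" and c: "0 < c" and Vc: "\<And>x. R \<le> d x x\<^sub>0 \<Longrightarrow> c / d x x\<^sub>0 \<le> V x"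
    and S: "\<And>A. \<lbrakk>finite A; \<And>x. x \<in> A \<Longrightarrow> 1 \<le> d x x\<^sub>0\<rbrakk> \<Longrightarrow> (\<Sum>x\<in>A. exp (- d x x\<^sub>0) * \<mu> x) \<le> S"
  shows "v x = 0"
proof (rule ccontr)
  define L where "L = (SUP x. v x)"
  define w where "w = (\<lambda>x. v x / L)"
  define \<theta> where "\<theta> = exp (- (c / (2 * energy_const)))"
  assume "v x \<noteq> 0"
  then have "0 < v x" using v(1)[of x] by simp
  also have vL: "v y \<le> L" for y unfolding L_def by (rule cSUP_upper) (use v in auto)
  then have "v x \<le> L" .
  finally have L: "0 < L" .
  have w: "0 \<le> w x" "w x \<le> 1" for x using v L vL by (auto simp: w_def)
  have wsub: "V x * w x * \<mu> x \<le> (\<Sum>y | \<omega> x y > 0. (w y - w x) * \<omega> x y)" for x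
  proof -
    have "V x * w x * \<mu> x = V x * v x * \<mu> x / L" by (simp add: w_def)
    also have "\<dots> \<le> (\<Sum>y | \<omega> x y > 0. (v y - v x) * \<omega> x y) / L"
      using sub L by (intro divide_right_mono) auto
    also have "\<dots> = (\<Sum>y | \<omega> x y > 0. (w y - w x) * \<omega> x y)"
      by (simp add: w_def sum_divide_distrib diff_divide_distrib[symmetric])
    finally show ?thesis .
  qed
  have gap: "w x \<le> \<theta>" if "R \<le> d x x\<^sub>0" for x
    unfolding \<theta>_def by (rule subsolution_gap[OF w V wsub R c Vc S that])
  have \<theta>: "\<theta> < 1" using c energy_const_pos by (simp add: \<theta>_def)
  let ?B = "{y. d y x\<^sub>0 < R}"
  have "x\<^sub>0 \<in> ?B" using R by (simp add: refl_zero)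
  then have ne: "w ` ?B \<noteq> {}" by blast
  have finB: "finite ?B" by (rule finite_ball)
  then have "Max (w ` ?B) \<in> w ` ?B" using ne by (intro Max_in) auto
  then obtain z where "w z = Max (w ` ?B)" by (metis imageE)
  then have z: "w y \<le> w z" if "y \<in> ?B" for y
    using that finB by simp
  have le: "w y \<le> max \<theta> (w z)" for y
    using gap[of y] z[of y] by (cases "R \<le> d y x\<^sub>0") (auto simp: max_def not_le)
  have "v y \<le> max \<theta> (w z) * L" for y
    using le[of y] L by (simp add: w_def pos_divide_le_eq)
  \<comment> \<open>As \<open>L\<close> is the least upper bound of \<open>v\<close>, the bound
    \<open>max \<theta> (w z)\<close> on \<open>w\<close> is at least 1; \<open>\<theta> < 1\<close>
    then forces the supremum to be attained at \<open>z\<close>.\<close>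
  then have "L \<le> max \<theta> (w z) * L" unfolding L_def[symmetric]
    by (subst L_def) (intro cSUP_least, auto)
  then have "1 \<le> max \<theta> (w z)" using L by simp
  then have "w z = 1" using \<theta> w(2)[of z] by linarith
  then have one: "w y = 1" for y
    using subsolution_eq_1[OF conn w V wsub] by blast
  \<comment> \<open>A finite ball cannot exhaust an infinite graph, and outside it
    \<open>w = 1\<close> contradicts the gap.\<close>
  have "?B \<noteq> UNIV" using finB infinite_vertices by metis
  then obtain y where "\<not> d y x\<^sub>0 < R" by blast
  then have "R \<le> d y x\<^sub>0" by simp
  then show False using gap[of y] one[of y] \<theta> by simp
qed

section \<open>From solutions to nonnegative subsolutions\<close>

lemma graph_laplacian_eq_sum:
  "graph_laplacian \<omega> \<mu> f x = (\<Sum>y | \<omega> x y > 0. (f y - f x) * \<omega> x y) / \<mu> x"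
proof -
  have "(\<Sum>\<^sub>\<infinity>y. (f y - f x) * \<omega> x y) = (\<Sum>\<^sub>\<infinity>y\<in>{y. \<omega> x y > 0}. (f y - f x) * \<omega> x y)"
    using weight_pos_iff by (intro infsum_cong_neutral) auto
  then show ?thesis
    by (simp add: graph_laplacian_def infsum_finite finite_neighbours)
qed

text \<open>This is Kato's inequality: multiply the equation by \<open>sgn (u x)\<close> and use
  \<open>sgn (u x) * u y \<le> \<bar>u y\<bar>\<close>, with equality at \<open>y = x\<close>. The
  convention \<open>sgn 0 = 0\<close> covers zeros of \<open>u\<close>.\<close>

lemma abs_solution_is_subsolution:
  assumes "graph_laplacian \<omega> \<mu> u x - V x * u x = 0"
  shows "V x * \<bar>u x\<bar> * \<mu> x \<le> (\<Sum>y | \<omega> x y > 0. (\<bar>u y\<bar> - \<bar>u x\<bar>) * \<omega> x y)"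
proof -
  have eq: "V x * u x * \<mu> x = (\<Sum>y | \<omega> x y > 0. (u y - u x) * \<omega> x y)"
    using assms node_measure_pos[of x] by (simp add: graph_laplacian_eq_sum field_simps)
  have "V x * \<bar>u x\<bar> * \<mu> x = sgn (u x) * (V x * u x * \<mu> x)"
    by (simp add: sgn_if)
  also have "\<dots> = (\<Sum>y | \<omega> x y > 0. (sgn (u x) * u y - \<bar>u x\<bar>) * \<omega> x y)"
    unfolding eq sum_distrib_left by (rule sum.cong) (auto simp: sgn_if algebra_simps)
  also have "\<dots> \<le> (\<Sum>y | \<omega> x y > 0. (\<bar>u y\<bar> - \<bar>u x\<bar>) * \<omega> x y)"
    by (intro sum_mono mult_right_mono diff_right_mono) (auto simp: sgn_if)
  finally show ?thesis .
qed

end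

section \<open>Reduction of the theorem to bounded subsolutions\<close>

theorem theorem2p4:
  fixes \<omega> d :: "'a \<Rightarrow> 'a \<Rightarrow> real" and \<mu> V u :: "'a \<Rightarrow> real"
    and x\<^sub>0 :: 'a and R\<^sub>0 c\<^sub>0 \<alpha> :: real
  assumes "infinite_weighted_graph \<omega> \<mu>"
    and "connected_graph \<omega>"
    and "locally_finite_graph \<omega>"
    and "pseudo_metric d"
    and "intrinsic \<omega> \<mu> d"
    and "jump_size \<omega> d < \<infinity>"
    and "\<And>x r. r > 0 \<Longrightarrow> finite (pball d x r)"
    and "\<And>x. V x \<ge> 0"
    and "R\<^sub>0 > 0" and "c\<^sub>0 > 0" and "0 \<le> \<alpha>" and "\<alpha> \<le> 1"
    and "\<And>x. x \<in> UNIV - pball d x\<^sub>0 R\<^sub>0 \<Longrightarrow> V x \<ge> c\<^sub>0 * d x x\<^sub>0 powr (- \<alpha>)"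
    and "\<exists>\<Lambda>. 0 < \<Lambda> \<and> \<Lambda> < 1 \<and>
           (\<lambda>x. exp (- \<Lambda> * d x x\<^sub>0 powr \<alpha>) * \<mu> x) summable_on (UNIV - pball d x\<^sub>0 1)"
    and "bounded (range u)"
    and "\<And>x. graph_laplacian \<omega> \<mu> u x - V x * u x = 0"
  shows "\<forall>x. u x = 0"
proof -
  interpret infinite_weighted_graph \<omega> \<mu> by fact
  interpret pseudo_metric d by fact
  \<comment> \<open>The supremum of an empty set of jumps is minus infinity in \<open>ereal\<close>;
    \<open>max 0\<close> makes \<open>s\<close> a nonnegative real without a case
    distinction.\<close>
  define s where "s = real_of_ereal (max 0 (jump_size \<omega> d))"
  have s: "ereal s = max 0 (jump_size \<omega> d)"
    unfolding s_def using assms(6) by (intro ereal_real') (auto simp: max_def)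
  have jump: "d x y \<le> s" if "\<omega> x y > 0" for x y
  proof -
    have "ereal (d x y) \<le> jump_size \<omega> d"
      unfolding jump_size_def using that by (intro Sup_upper) auto
    then have "ereal (d x y) \<le> ereal s" unfolding s by (simp add: le_max_iff_disj)
    then show ?thesis by simp
  qed
  interpret proper_intrinsic_graph \<omega> d \<mu> s x\<^sub>0
  proof
    show "finite {y. \<omega> x y > 0}" for x
      using \<open>locally_finite_graph \<omega>\<close> weight_sym[of x]
      by (simp add: locally_finite_graph_def adjacent_def)
    show "(\<Sum>y\<in>A. \<omega> x y * (d x y)\<^sup>2) \<le> \<mu> x" if "finite A" for A x
    proof -
      have "(\<Sum>y\<in>A. \<omega> x y * (d x y)\<^sup>2) \<le> (\<Sum>\<^sub>\<infinity>y. \<omega> x y * (d x y)\<^sup>2)"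
        using \<open>intrinsic \<omega> \<mu> d\<close> that
        by (intro finite_sum_le_infsum) (auto simp: intrinsic_def weight_nonneg)
      also have "\<dots> \<le> \<mu> x"
      proof -
        have "1 / \<mu> x * (\<Sum>\<^sub>\<infinity>y. \<omega> x y * (d x y)\<^sup>2) \<le> 1"
          using \<open>intrinsic \<omega> \<mu> d\<close> unfolding intrinsic_def by blast
        then show ?thesis using node_measure_pos[of x] by (simp add: pos_divide_le_eq)
      qed
      finally show ?thesis .
    qed
    show "d x y \<le> s" if "\<omega> x y > 0" for x y using that by (rule jump)
    show "0 \<le> s" by (simp add: s_def real_of_ereal_pos)
    show "finite {y. d y x\<^sub>0 < r}" for r
    proof (rule finite_subset)
      \<comment> \<open>Finiteness is assumed for positive radii, hence
        \<open>max r 1\<close>.\<close>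
      show "{y. d y x\<^sub>0 < r} \<subseteq> pball d x\<^sub>0 (max r 1)" by (auto simp: pball_def)
    qed (rule assms(7), simp)
  qed
  obtain \<Lambda> where \<Lambda>: "0 < \<Lambda>" "\<Lambda> < 1"
    "(\<lambda>x. exp (- \<Lambda> * d x x\<^sub>0 powr \<alpha>) * \<mu> x) summable_on (UNIV - pball d x\<^sub>0 1)"
    using assms(14) by blast
  define S where "S = (\<Sum>\<^sub>\<infinity>x\<in>UNIV - pball d x\<^sub>0 1. exp (- \<Lambda> * d x x\<^sub>0 powr \<alpha>) * \<mu> x)"
  have \<mu>: "0 \<le> \<mu> x" for x using node_measure_pos[of x] by simp
  have S: "(\<Sum>x\<in>A. exp (- d x x\<^sub>0) * \<mu> x) \<le> S" if A: "finite A" "\<And>x. x \<in> A \<Longrightarrow> 1 \<le> d x x\<^sub>0" for A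
  proof -
    have "(\<Sum>x\<in>A. exp (- d x x\<^sub>0) * \<mu> x) \<le> (\<Sum>x\<in>A. exp (- \<Lambda> * d x x\<^sub>0 powr \<alpha>) * \<mu> x)"
    proof (rule sum_mono)
      fix x assume "x \<in> A"
      then have "d x x\<^sub>0 powr \<alpha> \<le> d x x\<^sub>0 powr 1"
        using A(2) \<open>\<alpha> \<le> 1\<close> by (intro powr_mono) auto
      then have "\<Lambda> * d x x\<^sub>0 powr \<alpha> \<le> 1 * d x x\<^sub>0"
        using \<Lambda> A(2)[OF \<open>x \<in> A\<close>] by (intro mult_mono) auto
      then show "exp (- d x x\<^sub>0) * \<mu> x \<le> exp (- \<Lambda> * d x x\<^sub>0 powr \<alpha>) * \<mu> x"
        using \<mu> by (intro mult_right_mono) auto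
    qed
    also have "\<dots> \<le> S"
      unfolding S_def using \<Lambda>(3) A(1) \<mu>
      by (intro finite_sum_le_infsum) (auto simp: pball_def not_less dest: A(2))
    finally show ?thesis .
  qed
  \<comment> \<open>The radius is raised to at least 1, where exponent -1 gives a power no larger
    than exponent \<open>- \<alpha>\<close>.\<close>
  have Vc: "c\<^sub>0 / d x x\<^sub>0 \<le> V x" if x: "max 1 R\<^sub>0 \<le> d x x\<^sub>0" for x
  proof -
    have "d x x\<^sub>0 powr (- 1) \<le> d x x\<^sub>0 powr (- \<alpha>)"
      using x \<open>\<alpha> \<le> 1\<close> by (intro powr_mono) auto
    then have "c\<^sub>0 * d x x\<^sub>0 powr (- 1) \<le> c\<^sub>0 * d x x\<^sub>0 powr (- \<alpha>)"
      using \<open>c\<^sub>0 > 0\<close> by (intro mult_left_mono) auto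
    also have "\<dots> \<le> V x" using x by (intro assms(13)) (auto simp: pball_def)
    finally show ?thesis using x by (simp add: powr_minus_divide)
  qed
  obtain b where b: "\<And>x. \<bar>u x\<bar> \<le> b"
    using \<open>bounded (range u)\<close> by (auto simp: bounded_iff)
  have "bdd_above (range (\<lambda>x. \<bar>u x\<bar>))" by (rule bdd_aboveI2) (rule b)
  then have "\<bar>u x\<bar> = 0" for x
  proof (rule bounded_subsolution_eq_0[where R = "max 1 R\<^sub>0", OF assms(2) abs_ge_zero _ assms(8) _ _ \<open>c\<^sub>0 > 0\<close> Vc S])
    show "V x * \<bar>u x\<bar> * \<mu> x \<le> (\<Sum>y | \<omega> x y > 0. (\<bar>u y\<bar> - \<bar>u x\<bar>) * \<omega> x y)" for x
      by (rule abs_solution_is_subsolution[OF assms(16)])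
  qed auto
  then show ?thesis by simp
qed

end
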